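(* Let $X$ be a shift space on a finite alphabet $A$ with a shift-invariant probability measure $\mu$, and let $\varphi\colon A^*\to G$ be a (monoid) morphism onto a finite group $G$. For every group language $L=\varphi^{-1}(K)$, where $K\subseteq G$, the density $\delta_\mu(L)$ exists. Moreover, if $\mu$ is ergodic, the density is given by $$\delta_\mu(L)=\sum_{g\in G}\bar\mu(\{g\}\times X)\,\bar\mu(gK\times X),$$ where $\bar\mu$ is any ergodic measure on the skew product $G\rtimes_\varphi X$ that projects to $\mu$.
   Context: A shift space on a finite alphabet $A$ is a nonempty closed subset $X\subseteq A^{\mathbb Z}$ invariant under the shift map $S((x_n)_n)=(x_{n+1})_n$, such that every letter of $A$ occurs in some element of $X$. Measures are Borel probability measures. For $x\in X$ and $i\le j$, $x_{[i,j)}=x_i x_{i+1}\cdots x_{j-1}$. For a language $L\subseteq A^*$, $[L\cap A^i]=\{x\in X: x_{[0,i)}\in L\}$, and the density of $L$ under $\mu$ is $\delta_\mu(L)=\lim_{n\to\infty}\frac1n\sum_{i=0}^{n-1}\mu([L\cap A^i])$ whenever this limit exists. The skew product $G\rtimes_\varphi X$ is the dynamical system $(G\times X,T_\varphi)$ with $G$ discrete and $T_\varphi(g,x)=(g\varphi(x_0),Sx)$. An ergodic measure on it is a $T_\varphi$-invariant ergodic Borel probability measure. A measure $\bar\mu$ on $G\rtimes_\varphi X$ projects to $\mu$ if $\bar\mu(G\times B)=\mu(B)$ for every measurable $B\subseteq X$. $gK=\{gk:k\in K\}$. *)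

theory Defs
  imports "HOL-Probability.Probability" "HOL-Algebra.Coset"
begin

definition borel_prob :: "'p topology \<Rightarrow> 'p measure \<Rightarrow> bool" where
  "borel_prob T M \<longleftrightarrow> prob_space M \<and> sets M = sets (sigma (topspace T) {U. openin T U})"

definition invariant_prob :: "'p topology \<Rightarrow> ('p \<Rightarrow> 'p) \<Rightarrow> 'p measure \<Rightarrow> bool" where
  "invariant_prob T f M \<longleftrightarrow> borel_prob T M \<and> f \<in> measurable M M \<and>
     (\<forall>B\<in>sets M. measure M (f -` B \<inter> space M) = measure M B)"

definition ergodic_prob :: "'p topology \<Rightarrow> ('p \<Rightarrow> 'p) \<Rightarrow> 'p measure \<Rightarrow> bool" where
  "ergodic_prob T f M \<longleftrightarrow> invariant_prob T f M \<and>
     (\<forall>B\<in>sets M. f -` B \<inter> space M = B \<longrightarrow> measure M B = 0 \<or> measure M B = 1)"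

definition shift :: "(int \<Rightarrow> 'a) \<Rightarrow> int \<Rightarrow> 'a" where
  "shift x = (\<lambda>n. x (n + 1))"

definition full_shift :: "'a set \<Rightarrow> (int \<Rightarrow> 'a) topology" where
  "full_shift A = product_topology (\<lambda>_. discrete_topology A) UNIV"

text \<open>The carrier of \<^term>\<open>full_shift A\<close> consists of all bi-infinite sequences with values in
  \<open>A\<close>. Shifts being invertible on it, invariance is \<open>S(X) = X\<close>.\<close>

definition shift_space :: "'a set \<Rightarrow> (int \<Rightarrow> 'a) set \<Rightarrow> bool" where
  "shift_space A X \<longleftrightarrow> X \<noteq> {} \<and> closedin (full_shift A) X \<and> shift ` X = X \<and>
     (\<forall>a\<in>A. \<exists>x\<in>X. \<exists>n. x n = a)"

definition shift_topology :: "'a set \<Rightarrow> (int \<Rightarrow> 'a) set \<Rightarrow> (int \<Rightarrow> 'a) topology" where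
  "shift_topology A X = subtopology (full_shift A) X"

definition factor :: "(int \<Rightarrow> 'a) \<Rightarrow> int \<Rightarrow> int \<Rightarrow> 'a list" where
  "factor x i j = map x [i..j - 1]"

text \<open>The set \<open>[L \<inter> A\<^sup>i]\<close>.\<close>

definition lang_cylinder :: "(int \<Rightarrow> 'a) set \<Rightarrow> 'a list set \<Rightarrow> nat \<Rightarrow> (int \<Rightarrow> 'a) set" where
  "lang_cylinder X L i = {x \<in> X. factor x 0 (int i) \<in> L}"

definition density_seq ::
    "(int \<Rightarrow> 'a) set \<Rightarrow> (int \<Rightarrow> 'a) measure \<Rightarrow> 'a list set \<Rightarrow> nat \<Rightarrow> real" where
  "density_seq X \<mu> L n = (1 / real n) * (\<Sum>i<n. measure \<mu> (lang_cylinder X L i))"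

definition density_exists ::
    "(int \<Rightarrow> 'a) set \<Rightarrow> (int \<Rightarrow> 'a) measure \<Rightarrow> 'a list set \<Rightarrow> bool" where
  "density_exists X \<mu> L \<longleftrightarrow> convergent (density_seq X \<mu> L)"

definition lang_density ::
    "(int \<Rightarrow> 'a) set \<Rightarrow> (int \<Rightarrow> 'a) measure \<Rightarrow> 'a list set \<Rightarrow> real" where
  "lang_density X \<mu> L = lim (density_seq X \<mu> L)"

definition word_monoid :: "'a set \<Rightarrow> 'a list monoid" where
  "word_monoid A = \<lparr>carrier = lists A, monoid.mult = (@), one = []\<rparr>"

definition group_language :: "'a set \<Rightarrow> ('a list \<Rightarrow> 'g) \<Rightarrow> 'g set \<Rightarrow> 'a list set" where
  "group_language A \<phi> K = {w \<in> lists A. \<phi> w \<in> K}"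

definition skew_topology ::
    "('g, 'm) monoid_scheme \<Rightarrow> 'a set \<Rightarrow> (int \<Rightarrow> 'a) set \<Rightarrow> ('g \<times> (int \<Rightarrow> 'a)) topology" where
  "skew_topology G A X = prod_topology (discrete_topology (carrier G)) (shift_topology A X)"

definition skew_map ::
    "('g, 'm) monoid_scheme \<Rightarrow> ('a list \<Rightarrow> 'g) \<Rightarrow> 'g \<times> (int \<Rightarrow> 'a) \<Rightarrow> 'g \<times> (int \<Rightarrow> 'a)" where
  "skew_map G \<phi> = (\<lambda>(g, x). (g \<otimes>\<^bsub>G\<^esub> \<phi> [x 0], shift x))"

definition projects_to ::
    "('g, 'm) monoid_scheme \<Rightarrow> ('g \<times> (int \<Rightarrow> 'a)) measure \<Rightarrow> (int \<Rightarrow> 'a) measure \<Rightarrow> bool" where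
  "projects_to G \<nu> \<mu> \<longleftrightarrow> (\<forall>B\<in>sets \<mu>. measure \<nu> (carrier G \<times> B) = measure \<mu> B)"

end

theory Submission imports Defs begin

text \<open>
  Write \<open>T\<close> for the skew product map. Since \<open>T\<^sup>i (g, x) = (g \<phi>(x\<^sub>0 \<dots> x\<^sub>i\<^sub>-\<^sub>1), S\<^sup>i x)\<close>, the slice
  of \<open>[L \<inter> A\<^sup>i]\<close> over \<open>g\<close> is \<open>{g} \<times> X \<inter> T\<^sup>-\<^sup>i (gK \<times> X)\<close>. So, for every invariant measure \<open>\<nu>\<close> on the
  skew product that projects to \<open>\<mu>\<close>, the density sequence is the sum over \<open>g\<close> of the Cesaro averages
  of the correlations \<open>\<nu>({g} \<times> X \<inter> T\<^sup>-\<^sup>i (gK \<times> X))\<close>, which converge by Birkhoff's theorem. The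
  product of the uniform measure on \<open>G\<close> with \<open>\<mu>\<close> is such a \<open>\<nu>\<close>, so the density exists; if \<open>\<nu>\<close> is
  ergodic, the correlations average to products of measures.

  Birkhoff's theorem rests on one inequality: \<open>\<integral>\<^sub>E f \<ge> 0\<close> for the invariant set \<open>E\<close> on which the
  Birkhoff sums of \<open>f\<close> are unbounded above. Indeed, if \<open>F\<^sub>n\<close> is the maximum of the sums of lengths
  \<open>0, \<dots>, n\<close>, then \<open>0 \<le> \<integral>\<^sub>E (F\<^sub>n\<^sub>+\<^sub>1 - F\<^sub>n) = \<integral>\<^sub>E (F\<^sub>n\<^sub>+\<^sub>1 - F\<^sub>n \<circ> T)\<close>, and the last integrand tends to
  \<open>f\<close> on \<open>E\<close>. Applied to \<open>\<plusminus>(f - h) - \<epsilon>\<close>, with \<open>h\<close> the conditional expectation of \<open>f\<close> on the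
  invariant sets, it shows that the averages of \<open>f\<close> converge to \<open>h\<close>.
\<close>

subsection \<open>Birkhoff's ergodic theorem\<close>

lemma integrable_imp_set_integrable:
  fixes f :: "'p \<Rightarrow> 'b::{banach, second_countable_topology}"
  shows "E \<in> sets M \<Longrightarrow> integrable M f \<Longrightarrow> set_integrable M E f"
  unfolding set_integrable_def by (rule integrable_mult_indicator)

definition birkhoff_sum :: "('p \<Rightarrow> 'p) \<Rightarrow> ('p \<Rightarrow> real) \<Rightarrow> nat \<Rightarrow> 'p \<Rightarrow> real" where
  "birkhoff_sum T f n x = (\<Sum>i<n. f ((T ^^ i) x))"

definition birkhoff_average :: "('p \<Rightarrow> 'p) \<Rightarrow> ('p \<Rightarrow> real) \<Rightarrow> nat \<Rightarrow> 'p \<Rightarrow> real" where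
  "birkhoff_average T f n x = birkhoff_sum T f n x / real n"

lemma birkhoff_sum_0 [simp]: "birkhoff_sum T f 0 x = 0"
  by (simp add: birkhoff_sum_def)

lemma birkhoff_sum_Suc: "birkhoff_sum T f (Suc n) x = f x + birkhoff_sum T f n (T x)"
  by (simp only: birkhoff_sum_def sum.lessThan_Suc_shift funpow_Suc_right o_apply funpow_0)

lemma birkhoff_sum_diff:
  "birkhoff_sum T (\<lambda>x. f x - g x) n x = birkhoff_sum T f n x - birkhoff_sum T g n x"
  by (simp add: birkhoff_sum_def sum_subtractf)

lemma birkhoff_average_uminus:
  "birkhoff_average T (\<lambda>x. - f x) n x = - birkhoff_average T f n x"
  by (simp add: birkhoff_average_def birkhoff_sum_def sum_negf)

lemma abs_birkhoff_average_le:
  assumes "\<And>x. \<bar>f x\<bar> \<le> C"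
  shows "\<bar>birkhoff_average T f n x\<bar> \<le> C"
proof -
  have "\<bar>birkhoff_sum T f n x\<bar> \<le> real n * C"
    using sum_bounded_above[of "{..<n}" "\<lambda>i. \<bar>f ((T ^^ i) x)\<bar>" C] sum_abs assms
    unfolding birkhoff_sum_def by (metis card_lessThan order_trans)
  moreover have "0 \<le> C" using assms abs_ge_zero order_trans by blast
  ultimately show ?thesis
    by (simp add: birkhoff_average_def divide_le_eq mult.commute)
qed

text \<open>The maximum of the Birkhoff sums of lengths \<open>0, \<dots>, n\<close>.\<close>

fun birkhoff_max :: "('p \<Rightarrow> 'p) \<Rightarrow> ('p \<Rightarrow> real) \<Rightarrow> nat \<Rightarrow> 'p \<Rightarrow> real" where
  "birkhoff_max T f 0 x = 0"
| "birkhoff_max T f (Suc n) x = max 0 (f x + birkhoff_max T f n (T x))"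

lemma birkhoff_max_nonneg: "0 \<le> birkhoff_max T f n x"
  by (cases n) auto

lemma birkhoff_sum_le_birkhoff_max: "birkhoff_sum T f n x \<le> birkhoff_max T f n x"
  by (induction n arbitrary: x) (auto simp: birkhoff_sum_Suc le_max_iff_disj)

lemma birkhoff_max_mono: "m \<le> n \<Longrightarrow> birkhoff_max T f m x \<le> birkhoff_max T f n x"
proof (rule lift_Suc_mono_le[of "\<lambda>n. birkhoff_max T f n x"])
  show "birkhoff_max T f n x \<le> birkhoff_max T f (Suc n) x" for n
    by (induction n arbitrary: x) (auto simp: max.coboundedI2 intro!: max.mono)
qed

lemma birkhoff_max_Suc_diff:
  "birkhoff_max T f (Suc n) x - birkhoff_max T f n (T x) = max (f x) (- birkhoff_max T f n (T x))"
  by (simp add: max_def)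

locale measure_preserving =
  fixes M :: "'p measure" and T :: "'p \<Rightarrow> 'p"
  assumes T_measurable [measurable]: "T \<in> M \<rightarrow>\<^sub>M M"
    and distr_T: "distr M M T = M"
begin

lemma funpow_measurable [measurable]: "T ^^ i \<in> M \<rightarrow>\<^sub>M M"
  by (induction i) (auto intro!: measurable_comp[OF _ T_measurable])

lemma birkhoff_sum_measurable [measurable]:
  "f \<in> borel_measurable M \<Longrightarrow> birkhoff_sum T f n \<in> borel_measurable M"
  unfolding birkhoff_sum_def
  by (intro borel_measurable_sum measurable_compose[OF funpow_measurable])

lemma birkhoff_average_measurable [measurable]:
  "f \<in> borel_measurable M \<Longrightarrow> birkhoff_average T f n \<in> borel_measurable M"
  unfolding birkhoff_average_def
  by (intro borel_measurable_divide birkhoff_sum_measurable borel_measurable_const)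

lemma integrable_T:
  fixes f :: "'p \<Rightarrow> 'b::{banach, second_countable_topology}"
  assumes "integrable M f"
  shows "integrable M (\<lambda>x. f (T x))"
  by (rule integrable_distr[OF T_measurable]) (simp add: distr_T assms)

lemma integral_T:
  fixes f :: "'p \<Rightarrow> 'b::{banach, second_countable_topology}"
  assumes [measurable]: "f \<in> borel_measurable M"
  shows "(\<integral>x. f (T x) \<partial>M) = integral\<^sup>L M f"
  by (subst (2) distr_T[symmetric]) (simp add: integral_distr)

definition invariants :: "'p measure" where
  "invariants = sigma (space M) {E \<in> sets M. T -` E \<inter> space M = E}"

lemma space_invariants [simp]: "space invariants = space M"
  by (simp add: invariants_def space_measure_of_conv)

lemma sets_invariants: "sets invariants = {E \<in> sets M. T -` E \<inter> space M = E}"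
proof -
  let ?I = "{E \<in> sets M. T -` E \<inter> space M = E}"
  have "sigma_algebra (space M) ?I"
    unfolding sigma_algebra_iff2
  proof (intro conjI ballI allI impI)
    show "?I \<subseteq> Pow (space M)"
      using sets.sets_into_space by blast
    show "space M - E \<in> ?I"
      if "E \<in> ?I" for E
      using that measurable_space[OF T_measurable] by blast
    show "\<Union> (range E) \<in> ?I"
      if "range E \<subseteq> ?I" for E :: "nat \<Rightarrow> 'p set"
      using that by (auto simp: vimage_UN UN_extend_simps simp flip: UN_simps)
  qed simp
  then show ?thesis unfolding invariants_def by (rule sigma_algebra.sets_measure_of_eq)
qed

lemma subalgebra_invariants: "subalgebra M invariants"
  by (auto simp: subalgebra_def sets_invariants)

lemma invariants_T_iff:
  "E \<in> sets invariants \<Longrightarrow> x \<in> space M \<Longrightarrow> T x \<in> E \<longleftrightarrow> x \<in> E"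
  by (auto simp: sets_invariants)

lemma invariant_function_T:
  fixes g :: "'p \<Rightarrow> 'b::t1_space"
  assumes g: "g \<in> borel_measurable invariants" and x: "x \<in> space M"
  shows "g (T x) = g x"
proof -
  have "g -` {g x} \<inter> space M \<in> sets invariants"
    using measurable_sets[OF g borel_singleton[of "{}" "g x"]] by simp
  from invariants_T_iff[OF this x] show ?thesis
    using x measurable_space[OF T_measurable] by auto
qed

lemma birkhoff_sum_invariant_function:
  assumes g: "g \<in> borel_measurable invariants" and x: "x \<in> space M"
  shows "birkhoff_sum T g n x = real n * g x"
  using x
proof (induction n arbitrary: x)
  case (Suc n)
  then show ?case
    using measurable_space[OF T_measurable] invariant_function_T[OF g]
    by (simp add: birkhoff_sum_Suc algebra_simps)
qed simp

lemma set_integral_T: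
  fixes f :: "'p \<Rightarrow> 'b::{banach, second_countable_topology}"
  assumes E: "E \<in> sets invariants" and [measurable]: "f \<in> borel_measurable M"
  shows "(LINT x:E|M. f (T x)) = (LINT x:E|M. f x)"
proof -
  have [measurable]: "E \<in> sets M" using E by (simp add: sets_invariants)
  have "(LINT x:E|M. f (T x)) = (\<integral>x. indicator E (T x) *\<^sub>R f (T x) \<partial>M)"
    unfolding set_lebesgue_integral_def
    by (rule Bochner_Integration.integral_cong) (auto simp: indicator_def invariants_T_iff[OF E])
  also have "\<dots> = (LINT x:E|M. f x)"
    unfolding set_lebesgue_integral_def by (rule integral_T) measurable
  finally show ?thesis .
qed

lemma integrable_birkhoff_max:
  assumes "integrable M f"
  shows "integrable M (birkhoff_max T f n)"
proof (induction n)
  case (Suc n)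
  have "integrable M (\<lambda>x. max 0 (f x + birkhoff_max T f n (T x)))"
    using assms integrable_T[OF Suc] by auto
  then show ?case by (simp add: fun_eq_iff cong: integrable_cong)
qed (simp cong: integrable_cong)

lemma set_integral_birkhoff_max_nonneg:
  assumes E: "E \<in> sets invariants" and f: "integrable M f"
  shows "0 \<le> (LINT x:E|M. max (f x) (- birkhoff_max T f n (T x)))"
proof -
  have E_sets: "E \<in> sets M" using E by (simp add: sets_invariants)
  have set_integrable: "set_integrable M E (birkhoff_max T f k)"
      "set_integrable M E (\<lambda>x. birkhoff_max T f k (T x))" for k
    using E_sets integrable_birkhoff_max[OF f] integrable_T[OF integrable_birkhoff_max[OF f]]
    by (simp_all add: integrable_imp_set_integrable)
  have "(LINT x:E|M. birkhoff_max T f n (T x)) = (LINT x:E|M. birkhoff_max T f n x)"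
    using integrable_birkhoff_max[OF f] by (intro set_integral_T[OF E] borel_measurable_integrable)
  also have "\<dots> \<le> (LINT x:E|M. birkhoff_max T f (Suc n) x)"
    by (intro set_integral_mono set_integrable(1) birkhoff_max_mono) simp
  finally have "0 \<le> (LINT x:E|M. birkhoff_max T f (Suc n) x - birkhoff_max T f n (T x))"
    using set_integral_diff(2)[OF set_integrable(1)[of "Suc n"] set_integrable(2)[of n]] by simp
  then show ?thesis by (simp only: birkhoff_max_Suc_diff)
qed

definition birkhoff_unbounded :: "('p \<Rightarrow> real) \<Rightarrow> 'p set" where
  "birkhoff_unbounded f = {x \<in> space M. \<not> bdd_above (range (\<lambda>n. birkhoff_sum T f n x))}"

lemma birkhoff_unbounded_invariant:
  assumes [measurable]: "f \<in> borel_measurable M"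
  shows "birkhoff_unbounded f \<in> sets invariants"
proof -
  have unbounded_iff: "\<not> bdd_above (range u) \<longleftrightarrow> (\<forall>k. \<exists>n. real k < u n)" for u :: "nat \<Rightarrow> real"
    unfolding bdd_above_def by (auto simp: not_le) (meson le_less_trans real_arch_simple)
  have "bdd_above (range (\<lambda>n. birkhoff_sum T f n (T x)))
    \<longleftrightarrow> bdd_above (range (\<lambda>n. birkhoff_sum T f n x))" for x
  proof
    assume "bdd_above (range (\<lambda>n. birkhoff_sum T f n (T x)))"
    then obtain C where "birkhoff_sum T f n (T x) \<le> C" for n by (auto simp: bdd_above_def)
    then have "birkhoff_sum T f n x \<le> max 0 (f x + C)" for n
      by (cases n) (auto simp: birkhoff_sum_Suc max.coboundedI2)
    then show "bdd_above (range (\<lambda>n. birkhoff_sum T f n x))" by (rule bdd_aboveI2)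
  next
    assume "bdd_above (range (\<lambda>n. birkhoff_sum T f n x))"
    then obtain C where "birkhoff_sum T f n x \<le> C" for n by (auto simp: bdd_above_def)
    from this[of "Suc _"] have "birkhoff_sum T f n (T x) \<le> C - f x" for n
      by (simp add: birkhoff_sum_Suc algebra_simps)
    then show "bdd_above (range (\<lambda>n. birkhoff_sum T f n (T x)))" by (rule bdd_aboveI2)
  qed
  then have "T -` birkhoff_unbounded f \<inter> space M = birkhoff_unbounded f"
    using measurable_space[OF T_measurable] by (auto simp: birkhoff_unbounded_def)
  moreover have "birkhoff_unbounded f \<in> sets M"
    unfolding birkhoff_unbounded_def unbounded_iff by measurable
  ultimately show ?thesis by (simp add: sets_invariants)
qed

theorem set_integral_birkhoff_unbounded_nonneg:
  assumes f: "integrable M f"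
  shows "0 \<le> (LINT x:birkhoff_unbounded f|M. f x)"
proof -
  note [measurable] = borel_measurable_integrable[OF f]
    borel_measurable_integrable[OF integrable_birkhoff_max[OF f]]
  let ?E = "birkhoff_unbounded f"
  have E: "?E \<in> sets invariants" by (rule birkhoff_unbounded_invariant) measurable
  then have [measurable]: "?E \<in> sets M" by (simp add: sets_invariants)
  have lim: "(\<lambda>n. indicator ?E x *\<^sub>R max (f x) (- birkhoff_max T f n (T x)))
    \<longlonglongrightarrow> indicator ?E x *\<^sub>R f x" if "x \<in> space M" for x
  proof (cases "x \<in> ?E")
    case True
    then have "T x \<in> ?E" using invariants_T_iff[OF E that] by simp
    then obtain k where less_sum: "- f x < birkhoff_sum T f k (T x)"
      unfolding birkhoff_unbounded_def bdd_above_def by (auto simp: not_le)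
    have "\<forall>\<^sub>F n in sequentially. max (f x) (- birkhoff_max T f n (T x)) = f x"
    proof (rule eventually_sequentiallyI[of k])
      fix n assume "k \<le> n"
      then show "max (f x) (- birkhoff_max T f n (T x)) = f x"
        using less_sum birkhoff_sum_le_birkhoff_max[of T f k "T x"]
          birkhoff_max_mono[of k n T f "T x"]
        by linarith
    qed
    then show ?thesis by (intro tendsto_scaleR tendsto_const tendsto_eventually)
  qed simp
  have bound: "\<bar>max (f x) (- birkhoff_max T f n (T x))\<bar> \<le> \<bar>f x\<bar>" for x n
    using birkhoff_max_nonneg[of T f n "T x"] by linarith
  have "(\<lambda>n. LINT x:?E|M. max (f x) (- birkhoff_max T f n (T x))) \<longlonglongrightarrow> (LINT x:?E|M. f x)"
    unfolding set_lebesgue_integral_def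
    by (rule integral_dominated_convergence[where w="\<lambda>x. \<bar>f x\<bar>"])
      (use f lim bound in \<open>auto simp: indicator_def\<close>)
  then show ?thesis
    by (rule LIMSEQ_le_const) (use set_integral_birkhoff_max_nonneg[OF E f] in blast)
qed

end

locale finite_measure_preserving = measure_preserving M T + finite_measure M
  for M :: "'p measure" and T
begin

sublocale invariants: finite_measure_subalgebra M invariants
  by unfold_locales (rule subalgebra_invariants)

lemma AE_bdd_above_birkhoff_sum:
  assumes f: "integrable M f"
    and neg: "\<And>E. E \<in> sets invariants \<Longrightarrow> 0 < measure M E \<Longrightarrow> (LINT x:E|M. f x) < 0"
  shows "AE x in M. bdd_above (range (\<lambda>n. birkhoff_sum T f n x))"
proof -
  let ?E = "birkhoff_unbounded f"
  have E: "?E \<in> sets invariants"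
    by (rule birkhoff_unbounded_invariant) (rule borel_measurable_integrable[OF f])
  have "\<not> 0 < measure M ?E"
    using neg[OF E] set_integral_birkhoff_unbounded_nonneg[OF f] by linarith
  then have "?E \<in> null_sets M"
    using E measure_nonneg[of M ?E] by (simp add: sets_invariants emeasure_eq_measure null_setsI)
  then have "AE x in M. x \<notin> ?E" by (rule AE_not_in)
  then show ?thesis by (auto simp: birkhoff_unbounded_def)
qed

lemma eventually_birkhoff_average_less:
  assumes f: "integrable M f" and nonpos: "\<And>E. E \<in> sets invariants \<Longrightarrow> (LINT x:E|M. f x) \<le> 0"
    and e: "0 < e"
  shows "AE x in M. \<forall>\<^sub>F n in sequentially. birkhoff_average T f n x < e"
proof -
  have "(LINT x:E|M. f x - e / 2) < 0" if E: "E \<in> sets invariants" "0 < measure M E" for E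
  proof -
    have E_sets: "E \<in> sets M" using E by (simp add: sets_invariants)
    have "(LINT x:E|M. f x - e / 2) = (LINT x:E|M. f x) - (LINT x:E|M. e / 2)"
      using f E_sets by (intro set_integral_diff) (simp_all add: integrable_imp_set_integrable)
    also have "\<dots> = (LINT x:E|M. f x) - e / 2 * measure M E"
      using E_sets by (simp add: set_lebesgue_integral_def)
    also have "\<dots> < 0" using nonpos[OF E(1)] mult_pos_pos[OF half_gt_zero[OF e] E(2)] by linarith
    finally show ?thesis .
  qed
  then have "AE x in M. bdd_above (range (\<lambda>n. birkhoff_sum T (\<lambda>x. f x - e / 2) n x))"
    using f by (intro AE_bdd_above_birkhoff_sum) auto
  then show ?thesis
  proof eventually_elim
    case (elim x)
    then obtain C where "birkhoff_sum T (\<lambda>x. f x - e / 2) n x \<le> C" for n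
      by (auto simp: bdd_above_def)
    then have sum_le: "birkhoff_sum T f n x \<le> C + real n * (e / 2)" for n
      by (simp add: birkhoff_sum_def sum_subtractf algebra_simps)
    obtain N :: nat where N_large: "C < real N * (e / 2)"
      using reals_Archimedean3[of "e / 2"] e by auto
    show ?case
    proof (rule eventually_sequentiallyI[of "Suc N"])
      fix n assume n: "Suc N \<le> n"
      then have "real N * (e / 2) \<le> real n * (e / 2)" using e by (intro mult_right_mono) auto
      then have "birkhoff_sum T f n x < real n * e" using sum_le[of n] N_large by linarith
      then show "birkhoff_average T f n x < e"
        using n by (simp add: birkhoff_average_def divide_less_eq mult.commute)
    qed
  qed
qed

lemma birkhoff_average_tendsto_0:
  assumes f: "integrable M f" and zero: "\<And>E. E \<in> sets invariants \<Longrightarrow> (LINT x:E|M. f x) = 0"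
  shows "AE x in M. (\<lambda>n. birkhoff_average T f n x) \<longlonglongrightarrow> 0"
proof -
  let ?e = "\<lambda>k. inverse (real (Suc k))"
  have "AE x in M. \<forall>\<^sub>F n in sequentially. \<bar>birkhoff_average T f n x\<bar> < ?e k" for k
  proof -
    have "(LINT x:E|M. - f x) = 0" if "E \<in> sets invariants" for E
      using zero[OF that] by (simp add: set_lebesgue_integral_def)
    then have "AE x in M. \<forall>\<^sub>F n in sequentially. birkhoff_average T (\<lambda>x. - f x) n x < ?e k"
      using f by (intro eventually_birkhoff_average_less) auto
    moreover have "AE x in M. \<forall>\<^sub>F n in sequentially. birkhoff_average T f n x < ?e k"
      using f zero by (intro eventually_birkhoff_average_less) auto
    ultimately show ?thesis
    proof eventually_elim
      case (elim x)
      then show ?case by eventually_elim (simp add: birkhoff_average_uminus abs_less_iff)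
    qed
  qed
  then have "AE x in M. \<forall>k. \<forall>\<^sub>F n in sequentially. \<bar>birkhoff_average T f n x\<bar> < ?e k"
    by (simp add: AE_all_countable)
  then show ?thesis
  proof eventually_elim
    case (elim x)
    show ?case
    proof (rule tendstoI)
      fix e :: real assume "0 < e"
      then obtain k where "?e k < e" using reals_Archimedean by blast
      with spec[OF elim, of k]
      show "\<forall>\<^sub>F n in sequentially. dist (birkhoff_average T f n x) 0 < e"
        by (auto elim: eventually_mono)
    qed
  qed
qed

theorem birkhoff_ergodic_theorem:
  assumes f: "integrable M f"
  shows "AE x in M. (\<lambda>n. birkhoff_average T f n x) \<longlonglongrightarrow> real_cond_exp M invariants f x"
proof -
  let ?g = "real_cond_exp M invariants f" and ?A = "birkhoff_average T"
  have g: "integrable M ?g" by (rule invariants.real_cond_exp_int(1)[OF f])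
  have "(LINT x:E|M. f x - ?g x) = 0" if E: "E \<in> sets invariants" for E
  proof -
    have "E \<in> sets M" using E by (simp add: sets_invariants)
    then have "(LINT x:E|M. f x - ?g x) = (LINT x:E|M. f x) - (LINT x:E|M. ?g x)"
      using f g by (intro set_integral_diff) (simp_all add: integrable_imp_set_integrable)
    then show ?thesis using invariants.real_cond_exp_intA[OF f E] by simp
  qed
  then have "AE x in M. (\<lambda>n. ?A (\<lambda>x. f x - ?g x) n x) \<longlonglongrightarrow> 0"
    using f g by (intro birkhoff_average_tendsto_0) auto
  then show ?thesis
  proof (rule AE_mp, intro AE_I2 impI)
    fix x assume x: "x \<in> space M" and lim: "(\<lambda>n. ?A (\<lambda>x. f x - ?g x) n x) \<longlonglongrightarrow> 0"
    have "\<forall>\<^sub>F n in sequentially. ?A (\<lambda>x. f x - ?g x) n x = ?A f n x - ?g x"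
      using birkhoff_sum_invariant_function[OF borel_measurable_cond_exp x]
      by (intro eventually_sequentiallyI[of 1])
        (simp add: birkhoff_average_def birkhoff_sum_diff diff_divide_distrib)
    with lim have "(\<lambda>n. ?A f n x - ?g x) \<longlonglongrightarrow> 0" by (rule Lim_transform_eventually)
    then show "(\<lambda>n. ?A f n x) \<longlonglongrightarrow> ?g x" by (simp only: LIM_zero_iff)
  qed
qed

end

subsection \<open>Averages of correlations\<close>

definition correlation_average ::
    "'p measure \<Rightarrow> ('p \<Rightarrow> 'p) \<Rightarrow> 'p set \<Rightarrow> 'p set \<Rightarrow> nat \<Rightarrow> real" where
  "correlation_average M T A B n
    = (\<Sum>i<n. measure M (A \<inter> ((T ^^ i) -` B \<inter> space M))) / real n"

context finite_measure_preserving
begin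

lemma correlation_average_eq_integral:
  assumes [measurable]: "A \<in> sets M" "B \<in> sets M"
  shows "correlation_average M T A B n = (LINT x:A|M. birkhoff_average T (indicator B) n x)"
proof -
  have [measurable]: "(T ^^ i) -` B \<inter> space M \<in> sets M" for i
    by (rule measurable_sets[OF funpow_measurable]) fact
  have "(LINT x:A|M. birkhoff_average T (indicator B) n x)
      = (\<integral>x. (\<Sum>i<n. indicator (A \<inter> ((T ^^ i) -` B \<inter> space M)) x) / real n \<partial>M)"
    unfolding set_lebesgue_integral_def birkhoff_average_def birkhoff_sum_def
    by (rule Bochner_Integration.integral_cong) (auto simp: indicator_def intro!: sum.cong)
  also have "\<dots> = (\<Sum>i<n. \<integral>x. indicator (A \<inter> ((T ^^ i) -` B \<inter> space M)) x \<partial>M) / real n"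
    by (simp add: Bochner_Integration.integral_sum less_top[symmetric])
  also have "\<dots> = correlation_average M T A B n"
    by (simp add: correlation_average_def Int_ac)
  finally show ?thesis ..
qed

theorem correlation_average_tendsto:
  assumes [measurable]: "A \<in> sets M" "B \<in> sets M"
  shows "correlation_average M T A B
    \<longlonglongrightarrow> (LINT x:A|M. real_cond_exp M invariants (indicator B) x)"
  unfolding correlation_average_eq_integral[OF assms, abs_def] set_lebesgue_integral_def
proof (rule integral_dominated_convergence[where w="\<lambda>_. 1"])
  have "AE x in M. (\<lambda>n. birkhoff_average T (indicator B) n x)
      \<longlonglongrightarrow> real_cond_exp M invariants (indicator B) x"
    by (rule birkhoff_ergodic_theorem) (simp add: less_top[symmetric])
  then show "AE x in M. (\<lambda>n. indicator A x *\<^sub>R birkhoff_average T (indicator B) n x)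
      \<longlonglongrightarrow> indicator A x *\<^sub>R real_cond_exp M invariants (indicator B) x"
    by eventually_elim (intro tendsto_intros)
  show "AE x in M. norm (indicator A x *\<^sub>R birkhoff_average T (indicator B) n x) \<le> 1" for n
    using abs_birkhoff_average_le[of "indicator B" 1 T n] by (auto simp: indicator_def)
qed auto

end

locale ergodic_measure_preserving = finite_measure_preserving M T + prob_space M
  for M :: "'p measure" and T +
  assumes ergodic: "E \<in> sets invariants \<Longrightarrow> prob E = 0 \<or> prob E = 1"
begin

lemma real_cond_exp_invariants_eq_expectation:
  assumes f: "integrable M f"
  shows "AE x in M. real_cond_exp M invariants f x = expectation f"
proof (rule invariants.real_cond_exp_charact[OF _ f])
  fix E assume E: "E \<in> sets invariants"
  then have E_sets [measurable]: "E \<in> sets M" by (simp add: sets_invariants)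
  note [measurable] = borel_measurable_integrable[OF f]
  from ergodic[OF E] show "(LINT x:E|M. f x) = (LINT x:E|M. expectation f)"
  proof
    assume "prob E = 0"
    then have "AE x in M. x \<notin> E"
      using E_sets by (simp add: AE_not_in emeasure_eq_measure null_setsI)
    then show ?thesis by (intro set_lebesgue_integral_cong_AE) auto
  next
    assume full: "prob E = 1"
    then have "AE x in M. x \<in> E" using prob_eq_1[OF E_sets] by simp
    then have "(LINT x:E|M. f x) = expectation f"
      unfolding set_lebesgue_integral_def by (intro integral_cong_AE) auto
    then show ?thesis using E_sets full by (simp add: set_lebesgue_integral_def)
  qed
qed simp_all

corollary correlation_average_ergodic:
  assumes A [measurable]: "A \<in> sets M" and B [measurable]: "B \<in> sets M"
  shows "correlation_average M T A B \<longlonglongrightarrow> prob A * prob B"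
proof -
  have "AE x in M. real_cond_exp M invariants (indicator B) x = prob B"
    using real_cond_exp_invariants_eq_expectation[of "indicator B"]
    by (simp add: less_top[symmetric])
  then have "(LINT x:A|M. real_cond_exp M invariants (indicator B) x) = (LINT x:A|M. prob B)"
    by (intro set_lebesgue_integral_cong_AE) auto
  also have "\<dots> = prob A * prob B" by (simp add: set_lebesgue_integral_def)
  finally show ?thesis using correlation_average_tendsto[OF A B] by simp
qed

end

subsection \<open>Borel sets of a topology\<close>

definition borel_of :: "'p topology \<Rightarrow> 'p measure" where
  "borel_of T = sigma (topspace T) {U. openin T U}"

lemma space_borel_of [simp]: "space (borel_of T) = topspace T"
  by (simp add: borel_of_def space_measure_of_conv)

lemma sets_borel_of: "sets (borel_of T) = sigma_sets (topspace T) {U. openin T U}"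
  unfolding borel_of_def by (rule sets_measure_of) (auto dest: openin_subset)

lemma openin_in_sets_borel_of: "openin T U \<Longrightarrow> U \<in> sets (borel_of T)"
  by (auto simp: sets_borel_of)

lemma continuous_map_measurable:
  assumes "continuous_map S T f"
  shows "f \<in> borel_of S \<rightarrow>\<^sub>M borel_of T"
  using assms unfolding borel_of_def[of T]
  by (intro measurable_measure_of)
    (auto simp: continuous_map_def vimage_def Int_def conj_commute dest: openin_subset
      intro!: openin_in_sets_borel_of)

lemma sets_borel_of_discrete_topology [simp]: "sets (borel_of (discrete_topology I)) = Pow I"
  using sets.space_closed[of "borel_of (discrete_topology I)"]
  by (auto intro!: openin_in_sets_borel_of)

lemma sets_pair_borel_of_discrete:
  assumes "countable I"
  shows "sets (count_space I \<Otimes>\<^sub>M borel_of T)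
    = sets (borel_of (prod_topology (discrete_topology I) T))"
    (is "sets ?P = sets (borel_of ?D)")
proof
  show "sets ?P \<subseteq> sets (borel_of ?D)"
  proof (rule sets_pair_in_sets)
    fix J B assume J: "J \<in> sets (count_space I)" and B: "B \<in> sets (borel_of T)"
    have "fst -` J \<inter> space (borel_of ?D) \<in> sets (borel_of ?D)"
      using J by (intro measurable_sets[OF continuous_map_measurable[OF continuous_map_fst]]) simp
    moreover have "snd -` B \<inter> space (borel_of ?D) \<in> sets (borel_of ?D)"
      using B by (intro measurable_sets[OF continuous_map_measurable[OF continuous_map_snd]])
    moreover have "J \<times> B = (fst -` J \<inter> space (borel_of ?D)) \<inter> (snd -` B \<inter> space (borel_of ?D))"
      using J sets.sets_into_space[OF B] by auto
    ultimately show "J \<times> B \<in> sets (borel_of ?D)" by simp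
  qed
  have "U \<in> sets ?P" if U: "openin ?D U" for U
  proof -
    have "openin T {x \<in> topspace T. (i, x) \<in> U}" if "i \<in> I" for i
      using U that by (intro openin_continuous_map_preimage[where Y = ?D] continuous_intros) auto
    then have "(\<Union>i\<in>I. {i} \<times> {x \<in> topspace T. (i, x) \<in> U}) \<in> sets ?P"
      using assms
      by (intro sets.countable_UN'') (auto intro!: openin_in_sets_borel_of)
    also have "(\<Union>i\<in>I. {i} \<times> {x \<in> topspace T. (i, x) \<in> U}) = U"
      using openin_subset[OF U] by auto
    finally show ?thesis .
  qed
  moreover have "topspace ?D = space ?P" by (simp add: space_pair_measure)
  ultimately show "sets (borel_of ?D) \<subseteq> sets ?P"
    unfolding sets_borel_of by (auto intro!: sets.sigma_sets_subset)
qed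

subsection \<open>Invariant Borel probability measures\<close>

lemma borel_prob_sets: "borel_prob T M \<Longrightarrow> sets M = sets (borel_of T)"
  by (simp add: borel_prob_def borel_of_def)

lemma borel_prob_space: "borel_prob T M \<Longrightarrow> space M = topspace T"
  using sets_eq_imp_space_eq[OF borel_prob_sets] by simp

lemma invariant_prob_iff_measure_preserving:
  "invariant_prob T f M \<longleftrightarrow> borel_prob T M \<and> measure_preserving M f"
proof
  assume inv: "invariant_prob T f M"
  then interpret prob_space M by (simp add: invariant_prob_def borel_prob_def)
  have f: "f \<in> M \<rightarrow>\<^sub>M M" using inv by (simp add: invariant_prob_def)
  have "distr M M f = M"
    by (rule measure_eqI)
      (use inv f in \<open>auto simp: emeasure_distr emeasure_eq_measure invariant_prob_def\<close>)
  with f inv show "borel_prob T M \<and> measure_preserving M f"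
    by (simp add: measure_preserving_def invariant_prob_def)
next
  assume M: "borel_prob T M \<and> measure_preserving M f"
  then interpret measure_preserving M f by simp
  have "measure M (f -` B \<inter> space M) = measure M B" if "B \<in> sets M" for B
    using measure_distr[OF T_measurable that] by (simp add: distr_T)
  with M show "invariant_prob T f M" by (simp add: invariant_prob_def T_measurable)
qed

lemma invariant_prob_finite_measure_preserving:
  "invariant_prob T f M \<Longrightarrow> finite_measure_preserving M f"
  by (auto simp: invariant_prob_iff_measure_preserving borel_prob_def finite_measure_preserving_def
    prob_space.finite_measure)

lemma ergodic_prob_ergodic_measure_preserving:
  assumes "ergodic_prob T f M"
  shows "ergodic_measure_preserving M f"
proof -
  interpret finite_measure_preserving M f
    using assms by (auto simp: ergodic_prob_def intro: invariant_prob_finite_measure_preserving)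
  interpret prob_space M
    using assms by (simp add: ergodic_prob_def invariant_prob_def borel_prob_def)
  show ?thesis
    by unfold_locales (use assms in \<open>auto simp: ergodic_prob_def sets_invariants\<close>)
qed

subsection \<open>Skew products with finite groups\<close>

lemma (in group) emeasure_uniform_right_translate:
  assumes fin: "finite (carrier G)" and c: "c \<in> carrier G" and H: "H \<subseteq> carrier G"
  shows "emeasure (uniform_count_measure (carrier G)) {g \<in> carrier G. g \<otimes> c \<in> H}
    = emeasure (uniform_count_measure (carrier G)) H"
proof -
  have "bij_betw (\<lambda>g. g \<otimes> c) {g \<in> carrier G. g \<otimes> c \<in> H} H"
    by (rule bij_betw_byWitness[where f' = "\<lambda>h. h \<otimes> inv c"]) (use c H in \<open>auto simp: m_assoc\<close>)
  then have "card {g \<in> carrier G. g \<otimes> c \<in> H} = card H" by (rule bij_betw_same_card)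
  then show ?thesis using fin H by (simp add: emeasure_uniform_count_measure)
qed

lemma (in group) measurable_skew_product:
  assumes "countable (carrier G)" and S: "S \<in> M \<rightarrow>\<^sub>M M" and c: "c \<in> M \<rightarrow>\<^sub>M count_space (carrier G)"
  shows "(\<lambda>(g, x). (g \<otimes> c x, S x))
    \<in> count_space (carrier G) \<Otimes>\<^sub>M M \<rightarrow>\<^sub>M count_space (carrier G) \<Otimes>\<^sub>M M"
proof (rule measurable_pair_measure_countable1)
  fix g assume "g \<in> carrier G"
  then have "(\<lambda>a. g \<otimes> a) \<in> count_space (carrier G) \<rightarrow>\<^sub>M count_space (carrier G)" by simp
  with S show "(\<lambda>x. case (g, x) of (g, x) \<Rightarrow> (g \<otimes> c x, S x)) \<in> M \<rightarrow>\<^sub>M count_space (carrier G) \<Otimes>\<^sub>M M"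
    by (simp add: measurable_Pair measurable_compose[OF c])
qed fact

lemma (in group) emeasure_slice_skew_product:
  fixes c :: "'p \<Rightarrow> 'a" and S :: "'p \<Rightarrow> 'p" and M :: "'p measure"
  defines "U \<equiv> uniform_count_measure (carrier G)"
  assumes fin: "finite (carrier G)" and H: "H \<in> sets U"
    and x: "x \<in> space M" and c: "c x \<in> carrier G"
  shows "emeasure U ((\<lambda>g. (g, x)) -` ((\<lambda>(g, x). (g \<otimes> c x, S x)) -` (H \<times> B) \<inter> space (U \<Otimes>\<^sub>M M)))
    = emeasure U H * indicator (S -` B \<inter> space M) x"
proof -
  have "(\<lambda>g. (g, x)) -` ((\<lambda>(g, x). (g \<otimes> c x, S x)) -` (H \<times> B) \<inter> space (U \<Otimes>\<^sub>M M))
      = (if S x \<in> B then {g \<in> carrier G. g \<otimes> c x \<in> H} else {})"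
    using x by (auto simp: U_def space_pair_measure space_uniform_count_measure)
  moreover have "H \<subseteq> carrier G"
    using H by (simp add: U_def sets_uniform_count_measure_count_space)
  ultimately show ?thesis
    using x emeasure_uniform_right_translate[OF fin c, of H] by (simp add: U_def indicator_def)
qed

theorem (in group) measure_preserving_skew_product:
  assumes fin: "finite (carrier G)" and "sigma_finite_measure M" and "measure_preserving M S"
    and c: "c \<in> M \<rightarrow>\<^sub>M count_space (carrier G)"
  shows "measure_preserving (uniform_count_measure (carrier G) \<Otimes>\<^sub>M M) (\<lambda>(g, x). (g \<otimes> c x, S x))"
    (is "measure_preserving (?U \<Otimes>\<^sub>M M) ?T")
proof -
  interpret measure_preserving M S by fact
  interpret U: prob_space ?U
    using fin by (intro prob_space_uniform_count_measure) auto
  interpret P: pair_sigma_finite ?U M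
    using assms(2) U.sigma_finite_measure_axioms by (simp add: pair_sigma_finite_def)
  have sets_eq: "sets (?U \<Otimes>\<^sub>M M) = sets (count_space (carrier G) \<Otimes>\<^sub>M M)"
    by (intro sets_pair_measure_cong sets_uniform_count_measure_count_space refl)
  have T: "?T \<in> ?U \<Otimes>\<^sub>M M \<rightarrow>\<^sub>M ?U \<Otimes>\<^sub>M M"
    unfolding measurable_cong_sets[OF sets_eq sets_eq]
    by (rule measurable_skew_product[OF countable_finite[OF fin] T_measurable c])
  have "?U \<Otimes>\<^sub>M M = distr (?U \<Otimes>\<^sub>M M) (?U \<Otimes>\<^sub>M M) ?T"
  proof (rule pair_measure_eqI)
    fix H B assume H: "H \<in> sets ?U" and B: "B \<in> sets M"
    let ?Q = "?T -` (H \<times> B) \<inter> space (?U \<Otimes>\<^sub>M M)"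
    have "emeasure (distr (?U \<Otimes>\<^sub>M M) (?U \<Otimes>\<^sub>M M) ?T) (H \<times> B) = emeasure (?U \<Otimes>\<^sub>M M) ?Q"
      using H B by (intro emeasure_distr T pair_measureI)
    also have "\<dots> = (\<integral>\<^sup>+x. emeasure ?U ((\<lambda>g. (g, x)) -` ?Q) \<partial>M)"
      using H B by (intro P.emeasure_pair_measure_alt2 measurable_sets[OF T] pair_measureI)
    also have "\<dots> = (\<integral>\<^sup>+x. emeasure ?U H * indicator (S -` B \<inter> space M) x \<partial>M)"
      using measurable_space[OF c]
      by (intro nn_integral_cong emeasure_slice_skew_product fin H) simp_all
    also have "\<dots> = emeasure ?U H * emeasure M (S -` B \<inter> space M)"
      using B by (intro nn_integral_cmult_indicator measurable_sets[OF T_measurable])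
    also have "\<dots> = emeasure ?U H * emeasure M B"
      using emeasure_distr[OF T_measurable B] by (simp add: distr_T)
    finally show "emeasure ?U H * emeasure M B
      = emeasure (distr (?U \<Otimes>\<^sub>M M) (?U \<Otimes>\<^sub>M M) ?T) (H \<times> B)" ..
  qed (use assms(2) U.sigma_finite_measure_axioms in auto)
  with T show ?thesis by (simp add: measure_preserving_def)
qed

subsection \<open>Densities of group languages\<close>

lemma factor_Suc: "factor x 0 (int (Suc i)) = factor x 0 (int i) @ [x (int i)]"
  using upto_rec2[of 0 "int i"] by (simp add: factor_def)

lemma funpow_shift: "(shift ^^ i) x n = x (n + int i)"
  by (induction i arbitrary: n) (auto simp: shift_def algebra_simps)

locale subshift =
  fixes A :: "'a set" and X :: "(int \<Rightarrow> 'a) set"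
  assumes shift_space: "shift_space A X"
begin

lemma X_subset_topspace: "X \<subseteq> topspace (full_shift A)"
  using shift_space closedin_subset[of "full_shift A" X] by (simp add: shift_space_def)

lemma topspace_shift_topology [simp]: "topspace (shift_topology A X) = X"
  using X_subset_topspace by (auto simp: shift_topology_def)

lemma letter_in: "x \<in> X \<Longrightarrow> x n \<in> A"
  using X_subset_topspace by (auto simp: full_shift_def PiE_iff)

lemma factor_in: "x \<in> X \<Longrightarrow> factor x i j \<in> lists A"
  by (auto simp: factor_def letter_in)

lemma funpow_shift_in: "x \<in> X \<Longrightarrow> (shift ^^ i) x \<in> X"
  using shift_space by (induction i) (auto simp: shift_space_def)

lemma continuous_map_letter:
  "continuous_map (shift_topology A X) (discrete_topology A) (\<lambda>x. x n)"
  unfolding shift_topology_def full_shift_def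
  by (intro continuous_map_from_subtopology continuous_map_product_projection) simp

lemma openin_lang_cylinder: "openin (shift_topology A X) (lang_cylinder X L i)"
proof (induction i arbitrary: L)
  case 0
  have "lang_cylinder X L 0 = (if [] \<in> L then X else {})"
    by (simp add: lang_cylinder_def factor_def)
  then show ?case using openin_topspace[of "shift_topology A X"] by simp
next
  case (Suc i)
  have "openin (shift_topology A X) {x \<in> X. x (int i) \<in> {a}}" if "a \<in> A" for a
    using openin_continuous_map_preimage[OF continuous_map_letter, of "{a}"] that by simp
  then have "openin (shift_topology A X)
      (\<Union>a\<in>A. lang_cylinder X {w. w @ [a] \<in> L} i \<inter> {x \<in> X. x (int i) \<in> {a}})"
    using Suc by (intro openin_Union openin_Int) auto
  also have "(\<Union>a\<in>A. lang_cylinder X {w. w @ [a] \<in> L} i \<inter> {x \<in> X. x (int i) \<in> {a}})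
      = lang_cylinder X L (Suc i)"
    by (auto simp: lang_cylinder_def factor_Suc letter_in simp del: of_nat_Suc)
  finally show ?case .
qed

end

locale subshift_cocycle = subshift A X + group G
  for A :: "'a set" and X and G :: "('g, 'm) monoid_scheme" (structure) +
  fixes \<phi> :: "'a list \<Rightarrow> 'g"
  assumes finite_carrier: "finite (carrier G)"
    and hom: "\<phi> \<in> hom (word_monoid A) G"
    and hom_Nil: "\<phi> [] = \<one>"
begin

lemma hom_append: "u \<in> lists A \<Longrightarrow> v \<in> lists A \<Longrightarrow> \<phi> (u @ v) = \<phi> u \<otimes> \<phi> v"
  using hom_mult[OF hom] by (simp add: word_monoid_def)

lemma hom_closed: "u \<in> lists A \<Longrightarrow> \<phi> u \<in> carrier G"
  using hom by (auto simp: hom_def word_monoid_def Pi_iff)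

lemma topspace_skew_topology [simp]: "topspace (skew_topology G A X) = carrier G \<times> X"
  by (simp add: skew_topology_def)

lemma openin_skew_topology_Times:
  "H \<subseteq> carrier G \<Longrightarrow> openin (shift_topology A X) U \<Longrightarrow> openin (skew_topology G A X) (H \<times> U)"
  by (simp add: skew_topology_def openin_prod_Times_iff)

lemma funpow_skew_map:
  assumes g: "g \<in> carrier G" and x: "x \<in> X"
  shows "(skew_map G \<phi> ^^ i) (g, x) = (g \<otimes> \<phi> (factor x 0 (int i)), (shift ^^ i) x)"
proof (induction i)
  case 0
  then show ?case using g by (simp add: factor_def hom_Nil)
next
  case (Suc i)
  have letter: "[x (int i)] \<in> lists A" using x by (simp add: letter_in)
  have "g \<otimes> \<phi> (factor x 0 (int (Suc i))) = g \<otimes> \<phi> (factor x 0 (int i)) \<otimes> \<phi> [x (int i)]"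
    unfolding factor_Suc using g factor_in[OF x] letter
    by (simp only: hom_append m_assoc hom_closed)
  then show ?case using Suc by (simp add: skew_map_def funpow_shift[of i x 0] del: of_nat_Suc)
qed

lemma fibre_preimage_coset:
  assumes g: "g \<in> carrier G" and K: "K \<subseteq> carrier G"
  shows "{g} \<times> X \<inter> ((skew_map G \<phi> ^^ i) -` ((g <# K) \<times> X) \<inter> carrier G \<times> X)
    = {g} \<times> lang_cylinder X (group_language A \<phi> K) i"
proof -
  have "g \<otimes> w \<in> g <# K \<longleftrightarrow> w \<in> K" if "w \<in> carrier G" for w
    using that g K by (auto simp: l_coset_def)
  moreover have "lang_cylinder X (group_language A \<phi> K) i = {x \<in> X. \<phi> (factor x 0 (int i)) \<in> K}"
    by (simp add: lang_cylinder_def group_language_def factor_in cong: conj_cong)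
  ultimately show ?thesis using g
    by (auto simp: funpow_skew_map funpow_shift_in hom_closed factor_in)
qed

theorem density_seq_eq_sum_correlation_average:
  assumes \<mu>: "borel_prob (shift_topology A X) \<mu>"
    and \<nu>: "invariant_prob (skew_topology G A X) (skew_map G \<phi>) \<nu>"
    and proj: "projects_to G \<nu> \<mu>" and K: "K \<subseteq> carrier G"
  shows "density_seq X \<mu> (group_language A \<phi> K) n
    = (\<Sum>g\<in>carrier G. correlation_average \<nu> (skew_map G \<phi>) ({g} \<times> X) ((g <# K) \<times> X) n)"
proof -
  let ?C = "lang_cylinder X (group_language A \<phi> K)"
  have \<nu>_borel: "borel_prob (skew_topology G A X) \<nu>" using \<nu> by (simp add: invariant_prob_def)
  then interpret N: prob_space \<nu> by (simp add: borel_prob_def)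
  have cylinder_sets: "?C i \<in> sets \<mu>" for i
    by (simp add: borel_prob_sets[OF \<mu>] openin_in_sets_borel_of openin_lang_cylinder)
  have fibre_sets: "{g} \<times> ?C i \<in> sets \<nu>" if "g \<in> carrier G" for g i
    using that by (simp add: borel_prob_sets[OF \<nu>_borel] openin_in_sets_borel_of
      openin_skew_topology_Times openin_lang_cylinder)
  have "measure \<mu> (?C i) = (\<Sum>g\<in>carrier G. measure \<nu> ({g} \<times> ?C i))" for i
  proof -
    have "measure \<mu> (?C i) = measure \<nu> (carrier G \<times> ?C i)"
      using proj cylinder_sets by (simp add: projects_to_def)
    also have "carrier G \<times> ?C i = (\<Union>g\<in>carrier G. {g} \<times> ?C i)" by auto
    also have "measure \<nu> \<dots> = (\<Sum>g\<in>carrier G. measure \<nu> ({g} \<times> ?C i))"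
      by (rule N.finite_measure_finite_Union[OF finite_carrier])
        (use fibre_sets in \<open>auto simp: disjoint_family_on_def\<close>)
    finally show ?thesis .
  qed
  moreover have "{g} \<times> X \<inter> ((skew_map G \<phi> ^^ i) -` ((g <# K) \<times> X) \<inter> space \<nu>) = {g} \<times> ?C i"
    if "g \<in> carrier G" for g i
    using fibre_preimage_coset[OF that K] by (simp add: borel_prob_space[OF \<nu>_borel])
  ultimately show ?thesis
    unfolding density_seq_def correlation_average_def
    by (simp add: sum.swap[of _ "{..<n}"] flip: sum_divide_distrib)
qed

lemma Times_X_in_sets:
  assumes "borel_prob (skew_topology G A X) \<nu>" and "H \<subseteq> carrier G"
  shows "H \<times> X \<in> sets \<nu>"
  using assms openin_topspace[of "shift_topology A X"]
  by (simp add: borel_prob_sets openin_in_sets_borel_of openin_skew_topology_Times)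

lemma letter_cocycle_measurable:
  assumes "borel_prob (shift_topology A X) \<mu>"
  shows "(\<lambda>x. \<phi> [x 0]) \<in> \<mu> \<rightarrow>\<^sub>M count_space (carrier G)"
proof -
  have "continuous_map (shift_topology A X) (discrete_topology (carrier G))
      ((\<lambda>a. \<phi> [a]) \<circ> (\<lambda>x. x 0))"
    by (rule continuous_map_compose[OF continuous_map_letter]) (auto intro: hom_closed)
  from continuous_map_measurable[OF this] show ?thesis
    using measurable_cong_sets[OF borel_prob_sets[OF assms],
        of "count_space (carrier G)" "borel_of (discrete_topology (carrier G))"]
    by (simp add: o_def)
qed

theorem uniform_lift:
  assumes \<mu>: "invariant_prob (shift_topology A X) shift \<mu>"
  defines "\<nu> \<equiv> uniform_count_measure (carrier G) \<Otimes>\<^sub>M \<mu>"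
  shows "invariant_prob (skew_topology G A X) (skew_map G \<phi>) \<nu>" and "projects_to G \<nu> \<mu>"
proof -
  have \<mu>_borel: "borel_prob (shift_topology A X) \<mu>"
    and shift_preserving: "measure_preserving \<mu> shift"
    using \<mu> by (simp_all add: invariant_prob_iff_measure_preserving)
  interpret U: prob_space "uniform_count_measure (carrier G)"
    using finite_carrier by (intro prob_space_uniform_count_measure) auto
  interpret \<mu>: prob_space \<mu> using \<mu>_borel by (simp add: borel_prob_def)
  interpret P: pair_prob_space "uniform_count_measure (carrier G)" \<mu> ..
  have "sets \<nu> = sets (count_space (carrier G) \<Otimes>\<^sub>M borel_of (shift_topology A X))"
    unfolding \<nu>_def
    by (intro sets_pair_measure_cong sets_uniform_count_measure_count_space borel_prob_sets \<mu>_borel)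
  also have "\<dots> = sets (borel_of (skew_topology G A X))"
    unfolding skew_topology_def
    by (rule sets_pair_borel_of_discrete) (rule countable_finite[OF finite_carrier])
  finally have "borel_prob (skew_topology G A X) \<nu>"
    using P.prob_space_axioms by (simp add: borel_prob_def borel_of_def \<nu>_def)
  moreover have "measure_preserving \<nu> (skew_map G \<phi>)"
    unfolding \<nu>_def skew_map_def
    using measure_preserving_skew_product[OF finite_carrier \<mu>.sigma_finite_measure_axioms
        shift_preserving letter_cocycle_measurable[OF \<mu>_borel]] .
  ultimately show "invariant_prob (skew_topology G A X) (skew_map G \<phi>) \<nu>"
    by (simp add: invariant_prob_iff_measure_preserving)
  have "measure \<nu> (carrier G \<times> B) = measure \<mu> B" if "B \<in> sets \<mu>" for B
    using \<mu>.emeasure_pair_measure_Times[OF sets.top[of "uniform_count_measure (carrier G)"] that]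
      U.emeasure_space_1
    by (simp add: \<nu>_def measure_def space_uniform_count_measure)
  then show "projects_to G \<nu> \<mu>" by (simp add: projects_to_def)
qed

theorem density_exists_group_language:
  assumes \<mu>: "invariant_prob (shift_topology A X) shift \<mu>" and K: "K \<subseteq> carrier G"
  shows "density_exists X \<mu> (group_language A \<phi> K)"
proof -
  obtain \<nu> where \<nu>: "invariant_prob (skew_topology G A X) (skew_map G \<phi>) \<nu>" "projects_to G \<nu> \<mu>"
    using uniform_lift[OF \<mu>] by blast
  interpret N: finite_measure_preserving \<nu> "skew_map G \<phi>"
    using \<nu>(1) by (rule invariant_prob_finite_measure_preserving)
  have \<nu>_borel: "borel_prob (skew_topology G A X) \<nu>"
    and \<mu>_borel: "borel_prob (shift_topology A X) \<mu>"
    using \<nu>(1) \<mu> by (simp_all add: invariant_prob_def)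
  have "convergent (\<lambda>n. \<Sum>g\<in>carrier G.
      correlation_average \<nu> (skew_map G \<phi>) ({g} \<times> X) ((g <# K) \<times> X) n)"
    using K by (intro convergent_sum convergentI[OF N.correlation_average_tendsto]
      Times_X_in_sets[OF \<nu>_borel] l_coset_subset_G) auto
  then show ?thesis
    by (simp add: density_exists_def
      density_seq_eq_sum_correlation_average[OF \<mu>_borel \<nu> K, abs_def])
qed

theorem lang_density_group_language:
  assumes \<mu>: "borel_prob (shift_topology A X) \<mu>"
    and \<nu>: "ergodic_prob (skew_topology G A X) (skew_map G \<phi>) \<nu>"
    and proj: "projects_to G \<nu> \<mu>" and K: "K \<subseteq> carrier G"
  shows "lang_density X \<mu> (group_language A \<phi> K)
    = (\<Sum>g\<in>carrier G. measure \<nu> ({g} \<times> X) * measure \<nu> ((g <# K) \<times> X))"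
proof -
  have inv: "invariant_prob (skew_topology G A X) (skew_map G \<phi>) \<nu>"
    using \<nu> by (simp add: ergodic_prob_def)
  then have \<nu>_borel: "borel_prob (skew_topology G A X) \<nu>" by (simp add: invariant_prob_def)
  interpret N: ergodic_measure_preserving \<nu> "skew_map G \<phi>"
    using \<nu> by (rule ergodic_prob_ergodic_measure_preserving)
  have "(\<lambda>n. \<Sum>g\<in>carrier G. correlation_average \<nu> (skew_map G \<phi>) ({g} \<times> X) ((g <# K) \<times> X) n)
    \<longlonglongrightarrow> (\<Sum>g\<in>carrier G. measure \<nu> ({g} \<times> X) * measure \<nu> ((g <# K) \<times> X))"
    using K by (intro tendsto_sum N.correlation_average_ergodic
      Times_X_in_sets[OF \<nu>_borel] l_coset_subset_G) auto
  then show ?thesis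
    unfolding lang_density_def density_seq_eq_sum_correlation_average[OF \<mu> inv proj K, abs_def]
    by (rule limI)
qed

end

theorem theorem1p1:
  fixes A :: "'a set" and X :: "(int \<Rightarrow> 'a) set" and \<mu> :: "(int \<Rightarrow> 'a) measure"
    and G :: "('g, 'm) monoid_scheme" and \<phi> :: "'a list \<Rightarrow> 'g" and K :: "'g set"
  assumes "finite A"
    and "shift_space A X"
    and "invariant_prob (shift_topology A X) shift \<mu>"
    and "group G" and "finite (carrier G)"
    and "\<phi> \<in> hom (word_monoid A) G" and "\<phi> [] = \<one>\<^bsub>G\<^esub>"
    and "\<phi> ` lists A = carrier G"
    and "K \<subseteq> carrier G"
  shows "density_exists X \<mu> (group_language A \<phi> K) \<and>
    (ergodic_prob (shift_topology A X) shift \<mu> \<longrightarrow>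
      (\<forall>\<nu> :: ('g \<times> (int \<Rightarrow> 'a)) measure.
        ergodic_prob (skew_topology G A X) (skew_map G \<phi>) \<nu> \<and> projects_to G \<nu> \<mu> \<longrightarrow>
        lang_density X \<mu> (group_language A \<phi> K) =
          (\<Sum>g\<in>carrier G. measure \<nu> ({g} \<times> X) * measure \<nu> ((g <#\<^bsub>G\<^esub> K) \<times> X))))"
proof -
  interpret group G by fact
  interpret subshift_cocycle A X G \<phi>
    using assms by unfold_locales auto
  show ?thesis
    using density_exists_group_language lang_density_group_language assms
    by (auto simp: invariant_prob_def)
qed

end
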